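(* Consider any recursive rational forecasting system $\varphi_r$ and any game-random prequential path $\upsilon=(\iota,\omega)\in(\mathcal{I}_r\times\{0,1\})^{\mathbb{N}}$. If $\varphi_r$ is more conservative on $\upsilon$, then $(\varphi_r[\omega],\omega)$ is game-random as well.
   Context: Let $\mathcal{X}=\{0,1\}$, $\mathbb{N}=\{1,2,\dots\}$ and $\mathbb{N}_0=\mathbb{N}\cup\{0\}$. An interval forecast is a non-empty closed interval $I\subseteq[0,1]$ (possibly a single point); $\mathcal{I}_r$ is the set of all interval forecasts with rational endpoints. For an interval forecast $I$ and $f\colon\mathcal{X}\to\mathbb{R}$, the upper expectation is $\overline{E}_I(f)=\max_{p\in I}[pf(1)+(1-p)f(0)]$. Situations are the elements $w$ of $\mathcal{X}^*=\bigcup_{k\in\mathbb{N}_0}\mathcal{X}^k$. A path is an element $\omega=(\omega_1,\omega_2,\dots)\in\mathcal{X}^{\mathbb{N}}$, with prefixes $\omega_{1:n}$ of length $n$. Prequential situations are the elements $v=(I_1,x_1,\dots,I_n,x_n)$ of $(\mathcal{I}_r\times\mathcal{X})^*=\bigcup_{k\in\mathbb{N}_0}(\mathcal{I}_r\times\mathcal{X})^k$, with the empty one denoted $\square$; $vI_rx$ is the concatenation of $v$ with $I_r\in\mathcal{I}_r$ and $x\in\mathcal{X}$. A prequential path is $\upsilon=(I_1,x_1,I_2,x_2,\dots)\in(\mathcal{I}_r\times\mathcal{X})^{\mathbb{N}}$, identified with the pair $(\iota,\omega)$ where $\iota=(I_1,I_2,\dots)$ and $\omega=(x_1,x_2,\dots)$;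 $\upsilon_{1:n}=(I_1,x_1,\dots,I_n,x_n)$. It is non-degenerate if $\iota_n\neq\{1-\omega_n\}$ for all $n\in\mathbb{N}$. A rational forecasting system is a map $\varphi_r\colon\mathcal{X}^*\to\mathcal{I}_r$; it is recursive if $w\mapsto\min\varphi_r(w)$ and $w\mapsto\max\varphi_r(w)$ are recursive (Turing-computable, via encodings) rational maps. For a path $\omega$, $\varphi_r[\omega]=(\varphi_r(\omega_{1:0}),\varphi_r(\omega_{1:1}),\varphi_r(\omega_{1:2}),\dots)$. The forecasting system $\varphi_r$ is more conservative on $\upsilon=(\iota,\omega)$ if $\iota_{n+1}\subseteq\varphi_r(\omega_{1:n})$ for all $n\in\mathbb{N}_0$. A test superfarthingale is a map $F\colon(\mathcal{I}_r\times\mathcal{X})^*\to\mathbb{R}$ with $F\geq0$, $F(\square)=1$ and $\overline{E}_{I_r}(F(vI_r\,\cdot))\leq F(v)$ for all prequential situations $v$ and all $I_r\in\mathcal{I}_r$, where $F(vI_r\,\cdot)$ is the map $x\mapsto F(vI_rx)$. A map $r\colon\mathcal{D}\to\mathbb{R}$ on a countable encoded set $\mathcal{D}$ is lower semicomputable if there is a recursive map $q\colon\mathcal{D}\times\mathbb{N}_0\to\mathbb{Q}$ with $q(d,n)\leq q(d,n+1)$ and $\lim_{m\to\infty}q(d,m)=r(d)$ for all $d,n$. A prequential path $\upsilon$ is game-random if it is non-degenerate and all lower semicomputable test superfarthingales $F$ satisfy $\limsup_{n\to\infty}F(\upsilon_{1:n})<\infty$. *)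

theory Defs
  imports Complex_Main "HOL-Library.Nat_Bijection" "HOL-Library.Extended_Real"
    "HOL-Library.Liminf_Limsup"
begin

text \<open>
  Recursive means computable by a Kleene program (zero, successor, projections, composition,
  primitive recursion, unbounded minimisation) that terminates on the given argument; this is
  the same class of maps as the one obtained from Turing machines. \<open>computes p xs y\<close>: program
  \<open>p\<close> halts on input \<open>xs\<close> with output \<open>y\<close>.
\<close>

datatype prog =
    Zero
  | Succ
  | Proj nat
  | Comp prog "prog list"
  | PrimRec prog prog
  | Mu prog

inductive computes :: "prog \<Rightarrow> nat list \<Rightarrow> nat \<Rightarrow> bool" where
  zero: "computes Zero xs 0"
| succ: "computes Succ [x] (Suc x)"
| proj: "i < length xs \<Longrightarrow> computes (Proj i) xs (xs ! i)"
| comp: "list_all2 (\<lambda>g y. computes g xs y) gs ys \<Longrightarrow> computes f ys z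
    \<Longrightarrow> computes (Comp f gs) xs z"
| primrec_0: "computes f xs y \<Longrightarrow> computes (PrimRec f g) (0 # xs) y"
| primrec_Suc: "computes (PrimRec f g) (n # xs) y \<Longrightarrow> computes g (n # y # xs) z
    \<Longrightarrow> computes (PrimRec f g) (Suc n # xs) z"
| mu: "(\<forall>i<n. \<exists>y. computes f (i # xs) (Suc y)) \<Longrightarrow> computes f (n # xs) 0
    \<Longrightarrow> computes (Mu f) xs n"

inductive_cases Zero_cases: "computes Zero xs y"
inductive_cases Succ_cases: "computes Succ xs y"
inductive_cases Proj_cases: "computes (Proj i) xs y"
inductive_cases Comp_cases: "computes (Comp f gs) xs y"
inductive_cases PrimRec_0_cases: "computes (PrimRec f g) (0 # xs) y"
inductive_cases PrimRec_Suc_cases: "computes (PrimRec f g) (Suc n # xs) y"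
inductive_cases Mu_cases: "computes (Mu f) xs y"

lemma computes_functional:
  "computes p xs y \<Longrightarrow> computes p xs z \<Longrightarrow> y = z"
proof (induction p xs y arbitrary: z rule: computes.induct)
  case (zero xs)
  then show ?case by (blast elim: Zero_cases)
next
  case (succ x)
  then show ?case by (blast elim: Succ_cases)
next
  case (proj i xs)
  from proj.prems show ?case by (rule Proj_cases) simp
next
  case (comp xs gs ys f u)
  from comp.prems obtain ys' where *: "list_all2 (\<lambda>g y. computes g xs y) gs ys'"
    and **: "computes f ys' z"
    by (rule Comp_cases)
  have "ys = ys'"
  proof (rule nth_equalityI)
    show "length ys = length ys'"
      using comp.IH(1) * by (simp add: list_all2_conv_all_nth)
    show "ys ! i = ys' ! i" if "i < length ys" for i
      using comp.IH(1) * that unfolding list_all2_conv_all_nth by metis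
  qed
  with comp.IH(2) ** show ?case by blast
next
  case (primrec_0 f xs y g)
  from primrec_0.prems have "computes f xs z" by (rule PrimRec_0_cases)
  then show ?case by (rule primrec_0.IH)
next
  case (primrec_Suc f g n xs y u)
  from primrec_Suc.prems obtain y' where *: "computes (PrimRec f g) (n # xs) y'"
    and **: "computes g (n # y' # xs) z"
    by (rule PrimRec_Suc_cases)
  from primrec_Suc.IH(1)[OF *] have "y = y'" .
  with ** show ?case using primrec_Suc.IH(2) by simp
next
  case (mu n f xs)
  from mu.prems have lt: "\<forall>i<z. \<exists>y. computes f (i # xs) (Suc y)"
    and z: "computes f (z # xs) 0"
    by (blast elim: Mu_cases)+
  have "\<not> n < z"
    using lt mu.IH(2) by (metis nat.distinct(1))
  moreover have "\<not> z < n"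
    using z mu.IH(1) by (metis nat.distinct(1))
  ultimately show ?case by simp
qed

text \<open>
  A map between two encoded sets. The program need not halt on numbers that are not codes;
  this does not matter as all sets of codes used below are decidable.
\<close>

definition recursive_map :: "('d \<Rightarrow> nat) \<Rightarrow> ('e \<Rightarrow> nat) \<Rightarrow> ('d \<Rightarrow> 'e) \<Rightarrow> bool" where
  "recursive_map enc_d enc_e f \<longleftrightarrow> (\<exists>p. \<forall>d. computes p [enc_d d] (enc_e (f d)))"

definition rat_code :: "rat \<Rightarrow> nat" where
  "rat_code r = (case quotient_of r of (a, b) \<Rightarrow> prod_encode (int_encode a, int_encode b))"

definition situation_code :: "bool list \<Rightarrow> nat" where
  "situation_code w = list_encode (map of_bool w)"

text \<open>A rational interval forecast is given by its pair of rational endpoints.\<close>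

typedef rat_forecast = "{I :: rat \<times> rat. 0 \<le> fst I \<and> fst I \<le> snd I \<and> snd I \<le> 1}"
  by (rule exI[of _ "(0, 1)"]) simp

definition min_forecast :: "rat_forecast \<Rightarrow> rat" where
  "min_forecast I = fst (Rep_rat_forecast I)"

definition max_forecast :: "rat_forecast \<Rightarrow> rat" where
  "max_forecast I = snd (Rep_rat_forecast I)"

definition forecast_set :: "rat_forecast \<Rightarrow> real set" where
  "forecast_set I = {real_of_rat (min_forecast I)..real_of_rat (max_forecast I)}"

lemma inj_forecast_set: "inj forecast_set"
proof (rule injI)
  fix I J assume eq: "forecast_set I = forecast_set J"
  have "min_forecast I \<le> max_forecast I" "min_forecast J \<le> max_forecast J"
    using Rep_rat_forecast[of I] Rep_rat_forecast[of J]
    by (auto simp: min_forecast_def max_forecast_def)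
  with eq have "min_forecast I = min_forecast J \<and> max_forecast I = max_forecast J"
    by (auto simp: forecast_set_def Icc_eq_Icc of_rat_less_eq)
  then show "I = J"
    by (metis Rep_rat_forecast_inject max_forecast_def min_forecast_def prod_eq_iff)
qed

text \<open>The supremum is attained whenever \<open>I\<close> is a non-empty closed subinterval of \<open>[0, 1]\<close>.\<close>

definition upper_expectation :: "real set \<Rightarrow> (bool \<Rightarrow> real) \<Rightarrow> real" where
  "upper_expectation I f = (SUP p\<in>I. p * f True + (1 - p) * f False)"

type_synonym preq_situation = "(rat_forecast \<times> bool) list"

definition preq_situation_code :: "preq_situation \<Rightarrow> nat" where
  "preq_situation_code v = list_encode (map (\<lambda>(I, x).
     prod_encode (prod_encode (rat_code (min_forecast I), rat_code (max_forecast I)),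
       of_bool x)) v)"

text \<open>
  Infinite sequences are indexed from 0, so \<open>u n\<close> is the \<open>(n + 1)\<close>-st entry and \<open>prefix u n\<close>
  consists of the first \<open>n\<close> entries.
\<close>

type_synonym path = "nat \<Rightarrow> bool"
type_synonym preq_path = "nat \<Rightarrow> rat_forecast \<times> bool"

definition prefix :: "(nat \<Rightarrow> 'a) \<Rightarrow> nat \<Rightarrow> 'a list" where
  "prefix u n = map u [0..<n]"

definition mk_preq_path :: "(nat \<Rightarrow> rat_forecast) \<Rightarrow> path \<Rightarrow> preq_path" where
  "mk_preq_path \<iota> \<omega> = (\<lambda>n. (\<iota> n, \<omega> n))"

definition nondegenerate :: "preq_path \<Rightarrow> bool" where
  "nondegenerate \<upsilon> \<longleftrightarrow> (\<forall>n. forecast_set (fst (\<upsilon> n)) \<noteq> {1 - of_bool (snd (\<upsilon> n))})"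

type_synonym forecasting_system = "bool list \<Rightarrow> rat_forecast"

definition recursive_forecasting_system :: "forecasting_system \<Rightarrow> bool" where
  "recursive_forecasting_system \<phi> \<longleftrightarrow>
     recursive_map situation_code rat_code (\<lambda>w. min_forecast (\<phi> w)) \<and>
     recursive_map situation_code rat_code (\<lambda>w. max_forecast (\<phi> w))"

definition forecasts_along :: "forecasting_system \<Rightarrow> path \<Rightarrow> nat \<Rightarrow> rat_forecast" where
  "forecasts_along \<phi> \<omega> = (\<lambda>n. \<phi> (prefix \<omega> n))"

definition more_conservative_on ::
    "forecasting_system \<Rightarrow> (nat \<Rightarrow> rat_forecast) \<Rightarrow> path \<Rightarrow> bool" where
  "more_conservative_on \<phi> \<iota> \<omega> \<longleftrightarrow>
     (\<forall>n. forecast_set (\<iota> n) \<subseteq> forecast_set (\<phi> (prefix \<omega> n)))"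

definition test_superfarthingale :: "(preq_situation \<Rightarrow> real) \<Rightarrow> bool" where
  "test_superfarthingale F \<longleftrightarrow>
     (\<forall>v. F v \<ge> 0) \<and> F [] = 1 \<and>
     (\<forall>v I. upper_expectation (forecast_set I) (\<lambda>x. F (v @ [(I, x)])) \<le> F v)"

definition lower_semicomputable :: "('d \<Rightarrow> nat) \<Rightarrow> ('d \<Rightarrow> real) \<Rightarrow> bool" where
  "lower_semicomputable enc r \<longleftrightarrow>
     (\<exists>q :: 'd \<times> nat \<Rightarrow> rat.
        recursive_map (\<lambda>(d, n). prod_encode (enc d, n)) rat_code q \<and>
        (\<forall>d n. q (d, n) \<le> q (d, Suc n)) \<and>
        (\<forall>d. (\<lambda>m. real_of_rat (q (d, m))) \<longlonglongrightarrow> r d))"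

definition game_random :: "preq_path \<Rightarrow> bool" where
  "game_random \<upsilon> \<longleftrightarrow> nondegenerate \<upsilon> \<and>
     (\<forall>F. test_superfarthingale F \<and> lower_semicomputable preq_situation_code F
        \<longrightarrow> limsup (\<lambda>n. ereal (F (prefix \<upsilon> n))) < \<infinity>)"

end

theory Submission
  imports Defs
begin

text \<open>
  Given a test superfarthingale \<open>F\<close>, let \<open>F'\<close> replace every forecast in a prequential situation
  by the one \<open>\<phi>\<close> makes after the same outcomes and then apply \<open>F\<close>, except that \<open>F'\<close> is \<open>0\<close> as
  soon as some replaced forecast is not included in that of \<open>\<phi>\<close>. As upper expectations are
  monotone in the interval, \<open>F'\<close> is a test superfarthingale, and it is lower semicomputable if \<open>F\<close>
  is, because \<open>\<phi>\<close> is recursive and inclusion of rational intervals is decidable. If \<open>\<phi>\<close> is more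
  conservative on \<open>(\<iota>, \<omega>)\<close>, then \<open>F'\<close> on \<open>(\<iota>, \<omega>)\<close> takes the values of \<open>F\<close> on \<open>(\<phi>[\<omega>], \<omega>)\<close>.
\<close>

section \<open>Recursive functions\<close>

text \<open>
  Encodings of the arguments are part of the predicate, so programs that halt only on codes are
  handled without explicit domains.
\<close>

definition computable :: "('a \<Rightarrow> nat list) \<Rightarrow> ('a \<Rightarrow> nat) \<Rightarrow> bool" where
  "computable e f \<longleftrightarrow> (\<exists>p. \<forall>a. computes p (e a) (f a))"

lemma recursive_map_iff_computable:
  "recursive_map enc_d enc_e f \<longleftrightarrow> computable (\<lambda>d. [enc_d d]) (\<lambda>d. enc_e (f d))"
  by (simp add: recursive_map_def computable_def)

text \<open>One program serves all arguments, hence any family of them. This specialises the program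
  of a step function, of \<open>\<phi>\<close> or of an approximation to the inputs that
  arise.\<close>

lemma computable_reindex:
  "computable e f \<Longrightarrow> computable (\<lambda>b. e (k b)) (\<lambda>b. f (k b))"
  by (auto simp: computable_def)

lemma computable_const: "computable e (\<lambda>_. k)"
proof (induction k)
  case 0
  show ?case unfolding computable_def by (blast intro: computes.zero)
next
  case (Suc k)
  then obtain p where "computes p (e a) k" for a by (auto simp: computable_def)
  then have "computes (Comp Succ [p]) (e a) (Suc k)" for a
    by (auto intro!: computes.comp[where ys = "[k]"] computes.succ)
  then show ?case by (auto simp: computable_def)
qed

lemma computable_arg0: "computable (\<lambda>a. x a # xs a) x"
  unfolding computable_def
  using computes.proj[of 0 "x a # xs a" for a] by (metis length_greater_0_conv list.discI nth_Cons_0)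

lemma computable_arg1: "computable (\<lambda>a. x a # y a # xs a) y"
proof -
  have "computes (Proj 1) (x a # y a # xs a) (y a)" for a
    using computes.proj[of 1 "x a # y a # xs a"] by simp
  then show ?thesis by (auto simp: computable_def)
qed

lemma computable_arg2: "computable (\<lambda>a. x a # y a # z a # xs a) z"
proof -
  have "computes (Proj 2) (x a # y a # z a # xs a) (z a)" for a
    using computes.proj[of 2 "x a # y a # z a # xs a"] by simp
  then show ?thesis by (auto simp: computable_def)
qed

text \<open>Here \<open>f\<close> depends on \<open>a\<close>, not on \<open>x a\<close>: it
  suffices that one program turns the code \<open>x a\<close> into \<open>f a\<close>. No function
  on all naturals has to be named, so that program may diverge off the codes.\<close>

lemma computable_comp1:
  assumes "computable (\<lambda>a. [x a]) f" "computable e x"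
  shows "computable e f"
proof -
  obtain p q where "computes p [x a] (f a)" "computes q (e a) (x a)" for a
    using assms by (auto simp: computable_def)
  then have "computes (Comp p [q]) (e a) (f a)" for a
    by (auto intro!: computes.comp[where ys = "[x a]"])
  then show ?thesis by (auto simp: computable_def)
qed

lemma computable_comp2:
  assumes "computable (\<lambda>a. [x a, y a]) f" "computable e x" "computable e y"
  shows "computable e f"
proof -
  obtain p q r where "computes p [x a, y a] (f a)" "computes q (e a) (x a)"
      "computes r (e a) (y a)" for a
    using assms by (auto simp: computable_def)
  then have "computes (Comp p [q, r]) (e a) (f a)" for a
    by (auto intro!: computes.comp[where ys = "[x a, y a]"])
  then show ?thesis by (auto simp: computable_def)
qed

lemma computable_Suc:
  assumes "computable e f"
  shows "computable e (\<lambda>a. Suc (f a))"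
proof (rule computable_comp1[OF _ assms])
  show "computable (\<lambda>a. [f a]) (\<lambda>a. Suc (f a))"
    unfolding computable_def by (blast intro: computes.succ)
qed

text \<open>\<open>h a\<close> runs through the values of a primitive recursion with parameter
  \<open>x a\<close>. The step program has to be right only on the triples that occur.\<close>

lemma computable_primrec:
  assumes "computable e n" "computable e x"
    and "computable (\<lambda>a. [x a]) (\<lambda>a. h a 0)"
    and "computable (\<lambda>(a, k). [k, h a k, x a]) (\<lambda>(a, k). h a (Suc k))"
  shows "computable e (\<lambda>a. h a (n a))"
proof (rule computable_comp2[OF _ assms(1,2)])
  obtain p q where p: "computes p [x a] (h a 0)"
    and q: "computes q [k, h a k, x a] (h a (Suc k))" for a k
    using assms(3,4) by (auto simp: computable_def)
  have "computes (PrimRec p q) [k, x a] (h a k)" for a k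
    by (induction k) (auto intro: computes.primrec_0 p computes.primrec_Suc q)
  then show "computable (\<lambda>a. [n a, x a]) (\<lambda>a. h a (n a))" by (auto simp: computable_def)
qed

lemma computable_funpow:
  assumes "computable e n" "computable e (\<lambda>a. enc (s a))"
    and "computable (\<lambda>t. [enc t]) (\<lambda>t. enc (step t))"
  shows "computable e (\<lambda>a. enc ((step ^^ n a) (s a)))"
proof (rule computable_primrec[OF assms(1,2), where h = "\<lambda>a k. enc ((step ^^ k) (s a))"])
  show "computable (\<lambda>a. [enc (s a)]) (\<lambda>a. enc ((step ^^ 0) (s a)))"
    by (simp add: computable_arg0)
  show "computable (\<lambda>(a, k). [k, enc ((step ^^ k) (s a)), enc (s a)])
      (\<lambda>(a, k). enc ((step ^^ Suc k) (s a)))"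
    using computable_comp1[OF computable_reindex[OF assms(3)] computable_arg1]
    by (simp add: split_def)
qed

section \<open>Arithmetic and pairing\<close>

lemma computable_add:
  assumes "computable e f" "computable e g"
  shows "computable e (\<lambda>a. f a + g a)"
proof (rule computable_primrec[OF assms(2,1), where h = "\<lambda>a k. f a + k"])
  show "computable (\<lambda>a. [f a]) (\<lambda>a. f a + 0)" by (simp add: computable_arg0)
  show "computable (\<lambda>(a, k). [k, f a + k, f a]) (\<lambda>(a, k). f a + Suc k)"
    by (simp add: split_def computable_Suc[OF computable_arg1])
qed

lemma computable_mult:
  assumes "computable e f" "computable e g"
  shows "computable e (\<lambda>a. f a * g a)"
proof (rule computable_primrec[OF assms(2,1), where h = "\<lambda>a k. f a * k"])
  show "computable (\<lambda>a. [f a]) (\<lambda>a. f a * 0)" by (simp add: computable_const)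
  show "computable (\<lambda>(a, k). [k, f a * k, f a]) (\<lambda>(a, k). f a * Suc k)"
    by (simp add: split_def computable_add[OF computable_arg2 computable_arg1])
qed

lemma computable_pred:
  assumes "computable e f"
  shows "computable e (\<lambda>a. f a - 1)"
proof (rule computable_primrec[OF assms assms, where h = "\<lambda>a k. k - 1"])
  show "computable (\<lambda>a. [f a]) (\<lambda>a. 0 - 1)" by (rule computable_const)
  show "computable (\<lambda>(a, k). [k, k - 1, f a]) (\<lambda>(a, k). Suc k - 1)"
    by (simp add: split_def computable_arg0)
qed

lemma computable_diff:
  assumes "computable e f" "computable e g"
  shows "computable e (\<lambda>a. f a - g a)"
proof (rule computable_primrec[OF assms(2,1), where h = "\<lambda>a k. f a - k"])
  show "computable (\<lambda>a. [f a]) (\<lambda>a. f a - 0)" by (simp add: computable_arg0)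
  show "computable (\<lambda>(a, k). [k, f a - k, f a]) (\<lambda>(a, k). f a - Suc k)"
    using computable_pred[OF computable_arg1[of "\<lambda>(a, k). k" "\<lambda>(a, k). f a - k" "\<lambda>(a, k). [f a]"]]
    by (simp add: split_def)
qed

lemma computable_le:
  assumes "computable e f" "computable e g"
  shows "computable e (\<lambda>a. of_bool (f a \<le> g a))"
proof -
  have "of_bool (f a \<le> g a) = 1 - (f a - g a)" for a by simp
  then show ?thesis using assms by (simp only: computable_diff computable_const)
qed

lemma computable_conj:
  assumes "computable e (\<lambda>a. of_bool (P a))" "computable e (\<lambda>a. of_bool (Q a))"
  shows "computable e (\<lambda>a. of_bool (P a \<and> Q a))"
  using computable_mult[OF assms] by (simp add: of_bool_conj)

text \<open>Selection by arithmetic evaluates both branches, so each must be computable at every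
  argument, also where it is not selected.\<close>

lemma computable_if:
  assumes "computable e (\<lambda>a. of_bool (P a))" "computable e f" "computable e g"
  shows "computable e (\<lambda>a. if P a then f a else g a)"
proof -
  have "(if P a then f a else g a) = of_bool (P a) * f a + (1 - of_bool (P a)) * g a" for a
    by simp
  then show ?thesis
    using assms by (simp only: computable_add computable_mult computable_diff computable_const)
qed

lemma computable_triangle:
  assumes "computable e f"
  shows "computable e (\<lambda>a. triangle (f a))"
proof (rule computable_primrec[OF assms assms, where h = "\<lambda>a k. triangle k"])
  show "computable (\<lambda>a. [f a]) (\<lambda>a. triangle 0)" by (rule computable_const)
  show "computable (\<lambda>(a, k). [k, triangle k, f a]) (\<lambda>(a, k). triangle (Suc k))"
    by (simp add: split_def computable_add computable_Suc computable_arg0 computable_arg1)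
qed

lemma computable_prod_encode:
  "computable e f \<Longrightarrow> computable e g \<Longrightarrow> computable e (\<lambda>a. prod_encode (f a, g a))"
  by (simp add: prod_encode_def computable_add computable_triangle)

text \<open>The inverse of the Cantor pairing is found by walking along the antidiagonals.\<close>

definition antidiagonal :: "nat \<Rightarrow> nat" where
  "antidiagonal c = fst (prod_decode c) + snd (prod_decode c)"

lemma antidiagonal_prod_encode: "antidiagonal (prod_encode (m, n)) = m + n"
  by (simp add: antidiagonal_def)

text \<open>\<open>prod_encode (m, n)\<close> is \<open>triangle (m + n) + m\<close>, so the codes
  on antidiagonal \<open>s\<close> form a block starting at \<open>triangle s\<close>. Passing to
  \<open>Suc c\<close> leaves the block exactly when it reaches the start of the next one.\<close>

lemma antidiagonal_Suc:
  "antidiagonal (Suc c) =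
     antidiagonal c + of_bool (triangle (Suc (antidiagonal c)) \<le> Suc c)"
proof -
  obtain m n where c: "c = prod_encode (m, n)"
    by (metis prod_decode_inverse surj_pair)
  show ?thesis
  \<comment> \<open>\<open>n = 0\<close> marks the last code of a block.\<close>
  proof (cases n)
    case 0
    then have "Suc c = prod_encode (0, Suc m)" by (simp add: c prod_encode_def)
    then have "antidiagonal (Suc c) = Suc m" by (simp only: antidiagonal_prod_encode add_0)
    then show ?thesis using 0 by (simp add: c antidiagonal_prod_encode) (simp add: prod_encode_def)
  next
    case (Suc n')
    then have "Suc c = prod_encode (Suc m, n')" by (simp add: c prod_encode_def)
    then have "antidiagonal (Suc c) = Suc m + n'" by (simp only: antidiagonal_prod_encode)
    then show ?thesis using Suc by (simp add: c antidiagonal_prod_encode) (simp add: prod_encode_def)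
  qed
qed

lemma computable_antidiagonal:
  assumes "computable e f"
  shows "computable e (\<lambda>a. antidiagonal (f a))"
proof (rule computable_primrec[OF assms assms, where h = "\<lambda>a k. antidiagonal k"])
  show "computable (\<lambda>a. [f a]) (\<lambda>a. antidiagonal 0)" by (rule computable_const)
  show "computable (\<lambda>(a, k). [k, antidiagonal k, f a]) (\<lambda>(a, k). antidiagonal (Suc k))"
    unfolding antidiagonal_Suc split_def
    by (intro computable_add computable_le computable_triangle computable_Suc computable_arg0
        computable_arg1)
qed

text \<open>Subtracting the start of its block from a code leaves the first component. As a
  destruction rule this unpacks encoded tuples.\<close>

lemma computable_prod_encodeD1:
  assumes "computable e (\<lambda>a. prod_encode (f a, g a))"
  shows "computable e f"
proof -
  have "f a = prod_encode (f a, g a) - triangle (antidiagonal (prod_encode (f a, g a)))" for a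
    by (simp add: antidiagonal_prod_encode) (simp add: prod_encode_def)
  then have "f = (\<lambda>a. prod_encode (f a, g a) - triangle (antidiagonal (prod_encode (f a, g a))))"
    by blast
  moreover have "computable e \<dots>"
    by (intro computable_diff computable_triangle computable_antidiagonal assms)
  ultimately show ?thesis by simp
qed

lemma computable_prod_encodeD2:
  assumes "computable e (\<lambda>a. prod_encode (f a, g a))"
  shows "computable e g"
proof -
  have "g a = antidiagonal (prod_encode (f a, g a)) - f a" for a
    by (simp add: antidiagonal_prod_encode)
  then have "g = (\<lambda>a. antidiagonal (prod_encode (f a, g a)) - f a)"
    by blast
  moreover have "computable e \<dots>"
    by (intro computable_diff computable_antidiagonal assms computable_prod_encodeD1[OF assms])
  ultimately show ?thesis by simp
qed

lemma computable_fst_prod_decode: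
  "computable e f \<Longrightarrow> computable e (\<lambda>a. fst (prod_decode (f a)))"
  by (rule computable_prod_encodeD1[where g = "\<lambda>a. snd (prod_decode (f a))"]) simp

lemma computable_snd_prod_decode:
  "computable e f \<Longrightarrow> computable e (\<lambda>a. snd (prod_decode (f a)))"
  by (rule computable_prod_encodeD2[where f = "\<lambda>a. fst (prod_decode (f a))"]) simp

section \<open>Lists\<close>

lemma computable_list_encode_Cons:
  "computable e f \<Longrightarrow> computable e (\<lambda>a. list_encode (xs a)) \<Longrightarrow>
    computable e (\<lambda>a. list_encode (f a # xs a))"
  by (simp add: computable_Suc computable_prod_encode)

text \<open>Lets \<open>computable_fold\<close> use the code itself as the number of iterations, so
  no length has to be computed.\<close>

lemma length_le_list_encode: "length xs \<le> list_encode xs"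
proof (induction xs)
  case (Cons x xs)
  then show ?case using le_prod_encode_2[of "list_encode xs" x] by simp
qed simp

text \<open>Once the list is used up the step does nothing, so any bound on the length will do as
  the number of iterations.\<close>

lemma funpow_fold:
  assumes "length xs \<le> n"
  shows "((\<lambda>(xs, s). case xs of [] \<Rightarrow> ([], s) | x # ys \<Rightarrow> (ys, f x s)) ^^ n) (xs, s) =
    ([], fold f xs s)"
  using assms
proof (induction n arbitrary: xs s)
  case (Suc n)
  then show ?case by (cases xs) (simp_all del: funpow.simps add: funpow_Suc_right)
qed simp

text \<open>
  The program for \<open>f\<close> may loop on numbers that do not code a list element, hence the arbitrary
  element \<open>undefined\<close> when the list is used up.
\<close>

lemma computable_fold:
  fixes f :: "'b \<Rightarrow> 'c \<Rightarrow> 'c"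
  assumes "computable e (\<lambda>a. list_encode (map ea (xs a)))"
    and "computable e (\<lambda>a. es (s a))"
    and f: "computable (\<lambda>(x, t). [ea x, es t]) (\<lambda>(x, t). es (f x t))"
  shows "computable e (\<lambda>a. es (fold f (xs a) (s a)))"
proof -
  define step where
    "step = (\<lambda>(xs, s). case xs of [] \<Rightarrow> ([], s) | x # ys \<Rightarrow> (ys, f x s))"
  define enc where "enc = (\<lambda>(xs, t). prod_encode (list_encode (map ea xs), es t))"
  define head where "head = (\<lambda>xs. if xs = [] then undefined else hd xs :: 'b)"
  let ?e = "\<lambda>t. [enc t]" and ?l = "\<lambda>t. list_encode (map ea (fst t))"
  have fold: "(step ^^ list_encode (map ea (xs a))) (xs a, s a) = ([], fold f (xs a) (s a))" for a
    unfolding step_def using length_le_list_encode[of "map ea (xs a)"] by (intro funpow_fold) simp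
  have "computable ?e (\<lambda>t. prod_encode (?l t, es (snd t)))"
    by (simp add: enc_def split_def computable_arg0)
  then have l: "computable ?e ?l" and t: "computable ?e (\<lambda>t. es (snd t))"
    by (rule computable_prod_encodeD1, rule computable_prod_encodeD2)
  have nil: "computable ?e (\<lambda>t. of_bool (fst t = []))"
  proof -
    have "fst t = [] \<longleftrightarrow> ?l t \<le> 0" for t :: "'b list \<times> 'c" by (cases "fst t") simp_all
    then show ?thesis by (simp only: computable_le l computable_const)
  qed
  have head: "computable ?e (\<lambda>t. ea (head (fst t)))"
  proof -
    \<comment> \<open>A non-empty list has code \<open>Suc (prod_encode (x, c))\<close> with
      \<open>x\<close> the code of its head and \<open>c\<close> that of its tail, whence the
      \<open>- 1\<close> before decoding.\<close>
    have "ea (head (fst t)) =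
        (if fst t = [] then ea undefined else fst (prod_decode (?l t - 1)))" for t :: "'b list \<times> 'c"
      by (cases "fst t") (simp_all add: head_def)
    then show ?thesis
      by (simp only: computable_if nil computable_const computable_fst_prod_decode
          computable_pred l)
  qed
  have tl: "computable ?e (\<lambda>t. list_encode (map ea (tl (fst t))))"
  proof -
    have "list_encode (map ea (tl (fst t))) = (if fst t = [] then 0 else snd (prod_decode (?l t - 1)))"
      for t :: "'b list \<times> 'c" by (cases "fst t") simp_all
    then show ?thesis
      by (simp only: computable_if nil computable_const computable_snd_prod_decode
          computable_pred l)
  qed
  \<comment> \<open>This must hold for an empty list too, since \<open>computable_if\<close>
    evaluates both branches.\<close>
  have "computable ?e (\<lambda>t. es (f (head (fst t)) (snd t)))"
    using computable_reindex[OF f, of "\<lambda>t. (head (fst t), snd t)"]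
    by (intro computable_comp2[OF _ head t]) simp
  with t tl nil have "computable ?e (\<lambda>t. prod_encode (list_encode (map ea (tl (fst t))),
      if fst t = [] then es (snd t) else es (f (head (fst t)) (snd t))))"
    by (intro computable_prod_encode computable_if)
  moreover have "enc (step t) = prod_encode (list_encode (map ea (tl (fst t))),
      if fst t = [] then es (snd t) else es (f (head (fst t)) (snd t)))" for t
    by (cases t; cases "fst t") (simp_all add: enc_def step_def head_def)
  ultimately have "computable ?e (\<lambda>t. enc (step t))" by simp
  with assms(1,2) have
    "computable e (\<lambda>a. enc ((step ^^ list_encode (map ea (xs a))) (xs a, s a)))"
    by (intro computable_funpow) (simp_all add: enc_def computable_prod_encode)
  then show ?thesis
    unfolding fold enc_def prod.case by (rule computable_prod_encodeD2)
qed

lemma computable_list_encode_rev: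
  assumes "computable e (\<lambda>a. list_encode (xs a))"
  shows "computable e (\<lambda>a. list_encode (rev (xs a)))"
proof -
  have "computable e (\<lambda>a. list_encode (fold Cons (xs a) []))"
  proof (rule computable_fold[where ea = id])
    show "computable e (\<lambda>a. list_encode (map id (xs a)))" using assms by simp
    show "computable e (\<lambda>a. list_encode [])" by (rule computable_const)
    show "computable (\<lambda>(x, t). [id x, list_encode t]) (\<lambda>(x, t). list_encode (x # t))"
      unfolding split_def id_apply
      by (intro computable_list_encode_Cons computable_arg0 computable_arg1)
  qed
  then show ?thesis by (simp add: rev_conv_fold)
qed

text \<open>List codes give access to the front only, so appending is done between two reversals.
  Situations grow at the end.\<close>

lemma computable_list_encode_snoc:
  assumes "computable e (\<lambda>a. list_encode (xs a))" "computable e f"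
  shows "computable e (\<lambda>a. list_encode (xs a @ [f a]))"
proof -
  have "computable e (\<lambda>a. list_encode (rev (f a # rev (xs a))))"
    by (intro computable_list_encode_rev computable_list_encode_Cons assms)
  then show ?thesis by simp
qed

section \<open>Rational forecasts\<close>

text \<open>With positive denominators the order is decided by cross-multiplication.
  \<open>int_encode\<close> doubles a nonnegative integer, so both products of codes carry the same
  factor 4.\<close>

lemma rat_code_le_iff:
  assumes "0 \<le> r" "0 \<le> s"
  shows "r \<le> s \<longleftrightarrow> fst (prod_decode (rat_code r)) * snd (prod_decode (rat_code s)) \<le>
    fst (prod_decode (rat_code s)) * snd (prod_decode (rat_code r))"
proof -
  obtain a b c d where q: "quotient_of r = (a, b)" "quotient_of s = (c, d)"
    by (metis surj_pair)
  have pos: "0 < b" "0 < d" using q quotient_of_denom_pos by blast+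
  moreover have "0 \<le> a" "0 \<le> c"
    using assms q pos quotient_of_div[OF q(1)] quotient_of_div[OF q(2)]
    by (simp_all add: zero_le_divide_iff)
  ultimately obtain a' b' c' d' where n: "a = int a'" "b = int b'" "c = int c'" "d = int d'"
    by (metis nonneg_int_cases order_less_imp_le)
  have "r \<le> s \<longleftrightarrow> a * d \<le> c * b"
    by (simp add: rat_less_eq_code q mult.commute)
  also have "\<dots> \<longleftrightarrow> a' * d' \<le> c' * b'" by (simp add: n flip: of_nat_mult)
  finally show ?thesis
    by (simp add: rat_code_def q n int_encode_def sum_encode_def)
qed

lemma computable_rat_le:
  assumes "computable e (\<lambda>a. rat_code (r a))" "computable e (\<lambda>a. rat_code (s a))"
    and "\<And>a. 0 \<le> r a" "\<And>a. 0 \<le> s a"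
  shows "computable e (\<lambda>a. of_bool (r a \<le> s a))"
  unfolding rat_code_le_iff[OF assms(3,4)]
  by (intro computable_le computable_mult computable_fst_prod_decode computable_snd_prod_decode
      assms(1,2))

lemma forecast_bounds:
  "0 \<le> min_forecast I" "min_forecast I \<le> max_forecast I" "max_forecast I \<le> 1"
  using Rep_rat_forecast[of I] by (auto simp: min_forecast_def max_forecast_def)

lemma max_forecast_nonneg: "0 \<le> max_forecast I"
  using forecast_bounds[of I] by linarith

lemma forecast_set_nonempty: "forecast_set I \<noteq> {}"
  using forecast_bounds(2)[of I] by (simp add: forecast_set_def of_rat_less_eq)

lemma forecast_set_subset_unit: "forecast_set I \<subseteq> {0..1}"
  using forecast_bounds(1,3)[of I] by (auto simp: forecast_set_def dest: order_trans[rotated])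

lemma forecast_set_subset_iff:
  "forecast_set I \<subseteq> forecast_set J \<longleftrightarrow>
     min_forecast J \<le> min_forecast I \<and> max_forecast I \<le> max_forecast J"
  using forecast_bounds(2)[of I] by (simp add: forecast_set_def of_rat_less_eq)

section \<open>Upper expectations over rational forecasts\<close>

lemma upper_expectation_mono:
  assumes "forecast_set I \<subseteq> forecast_set J"
  shows "upper_expectation (forecast_set I) f \<le> upper_expectation (forecast_set J) f"
  unfolding upper_expectation_def
proof (rule cSUP_subset_mono[OF forecast_set_nonempty _ assms])
  \<comment> \<open>Monotonicity of real suprema needs a bound on the larger set; since
    \<open>p\<close> lies in the unit interval, each value is a convex combination.\<close>
  have "p * f True + (1 - p) * f False \<le> max (f True) (f False)" if "p \<in> forecast_set J" for p
    using that forecast_set_subset_unit[of J] by (intro convex_bound_le) auto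
  then show "bdd_above ((\<lambda>p. p * f True + (1 - p) * f False) ` forecast_set J)"
    by (meson bdd_aboveI2)
qed simp

lemma upper_expectation_zero: "upper_expectation (forecast_set I) (\<lambda>_. 0) = 0"
  by (simp add: upper_expectation_def forecast_set_nonempty)

section \<open>Replacing the forecasts\<close>

definition forecast_code :: "rat_forecast \<Rightarrow> nat" where
  "forecast_code I = prod_encode (rat_code (min_forecast I), rat_code (max_forecast I))"

definition entry_code :: "rat_forecast \<times> bool \<Rightarrow> nat" where
  "entry_code = (\<lambda>(I, x). prod_encode (forecast_code I, of_bool x))"

text \<open>Brings the code into the form that \<open>computable_fold\<close> expects.\<close>

lemma preq_situation_code_eq: "preq_situation_code v = list_encode (map entry_code v)"
  by (simp add: preq_situation_code_def entry_code_def forecast_code_def split_def)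

section \<open>Replay of a prequential situation with the forecasts of \<open>\<phi>\<close>\<close>

type_synonym replay_state = "bool list \<times> preq_situation \<times> bool"

text \<open>The state: outcomes so far, situation with replaced forecasts, have all inclusions held.\<close>

definition replay_step ::
    "forecasting_system \<Rightarrow> rat_forecast \<times> bool \<Rightarrow> replay_state \<Rightarrow> replay_state" where
  "replay_step \<phi> = (\<lambda>(I, x) (w, u, ok).
     (w @ [x], u @ [(\<phi> w, x)], ok \<and> forecast_set I \<subseteq> forecast_set (\<phi> w)))"

text \<open>A fold from the left, because the forecast substituted at an entry depends on the
  outcomes before it.\<close>

definition replay :: "forecasting_system \<Rightarrow> preq_situation \<Rightarrow> replay_state" where
  "replay \<phi> v = fold (replay_step \<phi>) v ([], [], True)"

lemma replay_Nil: "replay \<phi> [] = ([], [], True)"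
  by (simp add: replay_def)

lemma replay_snoc: "replay \<phi> (v @ [a]) = replay_step \<phi> a (replay \<phi> v)"
  by (simp add: replay_def)

definition replay_code :: "replay_state \<Rightarrow> nat" where
  "replay_code = (\<lambda>(w, u, ok).
     prod_encode (situation_code w, prod_encode (preq_situation_code u, of_bool ok)))"

lemma computable_replay_step:
  assumes "recursive_forecasting_system \<phi>"
  shows "computable (\<lambda>(a, t). [entry_code a, replay_code t])
    (\<lambda>(a, t). replay_code (replay_step \<phi> a t))"
proof -
  define e where "e = (\<lambda>p. [entry_code (fst p), replay_code (snd p)])"
  let ?I = "\<lambda>p. fst (fst p)" and ?x = "\<lambda>p. snd (fst p)" and ?w = "\<lambda>p. fst (snd p)"
    and ?u = "\<lambda>p. fst (snd (snd p))" and ?ok = "\<lambda>p. snd (snd (snd p))"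
  have entry: "computable e (\<lambda>p. prod_encode (prod_encode
      (rat_code (min_forecast (?I p)), rat_code (max_forecast (?I p))), of_bool (?x p)))"
    using computable_arg0[of "\<lambda>p. entry_code (fst p)"]
    by (simp add: e_def entry_code_def forecast_code_def split_def)
  note I = computable_prod_encodeD1[OF entry] and x = computable_prod_encodeD2[OF entry]
  have state: "computable e (\<lambda>p. prod_encode (situation_code (?w p),
      prod_encode (list_encode (map entry_code (?u p)), of_bool (?ok p))))"
    using computable_arg1[of "\<lambda>p. entry_code (fst p)" "\<lambda>p. replay_code (snd p)"]
    by (simp add: e_def replay_code_def split_def preq_situation_code_eq)
  note w = computable_prod_encodeD1[OF state]
    and u = computable_prod_encodeD1[OF computable_prod_encodeD2[OF state]]
    and ok = computable_prod_encodeD2[OF computable_prod_encodeD2[OF state]]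
  \<comment> \<open>The programs for \<open>\<phi>\<close> take codes of outcome lists; composed
    with the decoded outcomes they give the endpoints of the new forecast.\<close>
  have \<phi>: "computable (\<lambda>w. [situation_code w]) (\<lambda>w. rat_code (min_forecast (\<phi> w)))"
      "computable (\<lambda>w. [situation_code w]) (\<lambda>w. rat_code (max_forecast (\<phi> w)))"
    using assms by (simp_all add: recursive_forecasting_system_def recursive_map_iff_computable)
  note \<phi>_min = computable_comp1[OF computable_reindex[OF \<phi>(1)] w]
    and \<phi>_max = computable_comp1[OF computable_reindex[OF \<phi>(2)] w]
  have incl: "computable e (\<lambda>p. of_bool (forecast_set (?I p) \<subseteq> forecast_set (\<phi> (?w p))))"
    unfolding forecast_set_subset_iff
    by (intro computable_conj computable_rat_le forecast_bounds(1) max_forecast_nonneg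
        \<phi>_min \<phi>_max computable_prod_encodeD1[OF I] computable_prod_encodeD2[OF I])
  \<comment> \<open>The code of the next state, with the appended elements written out so that
    \<open>computable_list_encode_snoc\<close> applies.\<close>
  have "computable e (\<lambda>p. prod_encode (list_encode (map of_bool (?w p) @ [of_bool (?x p)]),
      prod_encode (list_encode (map entry_code (?u p) @ [prod_encode (prod_encode
        (rat_code (min_forecast (\<phi> (?w p))), rat_code (max_forecast (\<phi> (?w p)))),
          of_bool (?x p))]),
        of_bool (?ok p \<and> forecast_set (?I p) \<subseteq> forecast_set (\<phi> (?w p))))))"
    using w unfolding situation_code_def
    by (intro computable_prod_encode computable_list_encode_snoc computable_conj u x ok incl
        \<phi>_min \<phi>_max)
  then show ?thesis
    by (simp add: e_def replay_step_def replay_code_def split_def preq_situation_code_eq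
        situation_code_def entry_code_def forecast_code_def)
qed

lemma computable_replay:
  assumes "recursive_forecasting_system \<phi>" "computable e (\<lambda>a. preq_situation_code (v a))"
  shows "computable e (\<lambda>a. replay_code (replay \<phi> (v a)))"
  unfolding replay_def
proof (rule computable_fold[OF _ _ computable_replay_step[OF assms(1)]])
  show "computable e (\<lambda>a. list_encode (map entry_code (v a)))"
    using assms(2) by (simp add: preq_situation_code_eq)
qed (rule computable_const)

lemma prefix_Suc: "prefix u (Suc n) = prefix u n @ [u n]"
  by (simp add: prefix_def)

text \<open>The induction tracks the outcomes, which determine the next forecast of
  \<open>\<phi>\<close>, and the flag, which stays \<open>True\<close> by conservativeness.\<close>

lemma replay_prefix:
  assumes "more_conservative_on \<phi> \<iota> \<omega>"
  shows "replay \<phi> (prefix (mk_preq_path \<iota> \<omega>) n) =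
    (prefix \<omega> n, prefix (mk_preq_path (forecasts_along \<phi> \<omega>) \<omega>) n, True)"
proof (induction n)
  case 0
  show ?case by (simp add: prefix_def replay_Nil)
next
  case (Suc n)
  then show ?case
    using assms
    by (simp add: prefix_Suc replay_snoc replay_step_def mk_preq_path_def forecasts_along_def
        more_conservative_on_def)
qed

text \<open>The value type is left open because both the real-valued \<open>F\<close> and its
  rational approximations are transformed.\<close>

definition replayed ::
    "forecasting_system \<Rightarrow> (preq_situation \<Rightarrow> 'a::zero) \<Rightarrow> preq_situation \<Rightarrow> 'a" where
  "replayed \<phi> F v = (case replay \<phi> v of (w, u, ok) \<Rightarrow> if ok then F u else 0)"

section \<open>The transformed superfarthingale\<close>

lemma test_superfarthingale_replayed:
  assumes "test_superfarthingale F"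
  shows "test_superfarthingale (replayed \<phi> F)"
  unfolding test_superfarthingale_def
proof (intro conjI allI)
  have nonneg: "0 \<le> F v" and super: "upper_expectation (forecast_set I) (\<lambda>x. F (v @ [(I, x)])) \<le> F v"
    for v I
    using assms by (auto simp: test_superfarthingale_def)
  show "0 \<le> replayed \<phi> F v" for v by (simp add: replayed_def nonneg split_def)
  show "replayed \<phi> F [] = 1"
    using assms by (simp add: replayed_def replay_Nil test_superfarthingale_def)
  show "upper_expectation (forecast_set I) (\<lambda>x. replayed \<phi> F (v @ [(I, x)])) \<le> replayed \<phi> F v"
    for v I
  proof -
    obtain w u ok where r: "replay \<phi> v = (w, u, ok)" by (metis surj_pair)
    show ?thesis
    proof (cases "ok \<and> forecast_set I \<subseteq> forecast_set (\<phi> w)")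
      case True
      \<comment> \<open>By monotonicity pass from \<open>I\<close> to \<open>\<phi> w\<close>, where
        the superfarthingale property of \<open>F\<close> at \<open>u\<close> applies.\<close>
      then have "upper_expectation (forecast_set I) (\<lambda>x. F (u @ [(\<phi> w, x)])) \<le> F u"
        using upper_expectation_mono super order_trans by blast
      with True show ?thesis by (simp add: replayed_def replay_snoc replay_step_def r)
    next
      case False
      \<comment> \<open>The flag is lost before or at this step, whatever the outcome
        \<open>x\<close>.\<close>
      then have "replayed \<phi> F (v @ [(I, x)]) = 0" for x
        by (auto simp: replayed_def replay_snoc replay_step_def r)
      then show ?thesis
        by (simp add: upper_expectation_zero replayed_def r nonneg)
    qed
  qed
qed

text \<open>The replaced situation and the flag depend on the situation alone, not on the stage of
  approximation, so transforming each approximation keeps monotonicity and the limit.\<close>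

lemma lower_semicomputable_replayed:
  assumes "recursive_forecasting_system \<phi>" "lower_semicomputable preq_situation_code F"
  shows "lower_semicomputable preq_situation_code (replayed \<phi> F)"
proof -
  let ?enc = "\<lambda>(d, n). prod_encode (preq_situation_code d, n)"
  obtain q where rec: "recursive_map ?enc rat_code q"
    and mono: "\<And>d n. q (d, n) \<le> q (d, Suc n)"
    and lim: "\<And>d. (\<lambda>m. real_of_rat (q (d, m))) \<longlonglongrightarrow> F d"
    using assms(2) unfolding lower_semicomputable_def by blast
  define q' where "q' = (\<lambda>(v, n). replayed \<phi> (\<lambda>u. q (u, n)) v)"
  define e where "e = (\<lambda>p. [prod_encode (preq_situation_code (fst p), snd p)])"
  have q: "computable (\<lambda>p. [?enc p]) (\<lambda>p. rat_code (q p))"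
    using rec by (simp add: recursive_map_iff_computable)
  have "computable e (\<lambda>p. prod_encode (preq_situation_code (fst p), snd p))"
    unfolding e_def by (rule computable_arg0)
  then have v: "computable e (\<lambda>p. preq_situation_code (fst p))" and n: "computable e snd"
    by (rule computable_prod_encodeD1, rule computable_prod_encodeD2)
  let ?r = "\<lambda>p. replay \<phi> (fst p)"
  have "computable e (\<lambda>p. prod_encode (situation_code (fst (?r p)),
      prod_encode (preq_situation_code (fst (snd (?r p))), of_bool (snd (snd (?r p))))))"
    using computable_replay[OF assms(1) v] by (simp add: replay_code_def split_def)
  note state = computable_prod_encodeD2[OF this]
  note u = computable_prod_encodeD1[OF state] and ok = computable_prod_encodeD2[OF state]
  \<comment> \<open>\<open>q\<close> is evaluated even if the flag is \<open>False\<close>; the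
    replaced situation is a genuine one then too, so the program for \<open>q\<close> halts.\<close>
  have qu: "computable e (\<lambda>p. rat_code (q (fst (snd (?r p)), snd p)))"
    using computable_reindex[OF q, of "\<lambda>p. (fst (snd (?r p)), snd p)"]
    by (intro computable_comp1[OF _ computable_prod_encode[OF u n]]) simp
  have "computable e (\<lambda>p. rat_code (q' p))"
    using computable_if[OF ok qu computable_const[of e "rat_code 0"]]
    by (simp add: q'_def replayed_def split_def if_distrib[of rat_code])
  then have "recursive_map ?enc rat_code q'"
    by (simp add: recursive_map_iff_computable e_def split_def)
  moreover have "q' (d, n) \<le> q' (d, Suc n)" for d n
    using mono by (simp add: q'_def replayed_def split_def)
  moreover have "(\<lambda>m. real_of_rat (q' (d, m))) \<longlonglongrightarrow> replayed \<phi> F d" for d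
    using lim by (simp add: q'_def replayed_def split_def)
  ultimately show ?thesis unfolding lower_semicomputable_def by blast
qed

text \<open>A non-empty subset of a singleton is that singleton, so a degenerate forecast of
  \<open>\<phi>\<close> on the path would force the same one in \<open>\<iota>\<close>.\<close>

lemma nondegenerate_more_conservative:
  assumes "nondegenerate (mk_preq_path \<iota> \<omega>)" "more_conservative_on \<phi> \<iota> \<omega>"
  shows "nondegenerate (mk_preq_path (forecasts_along \<phi> \<omega>) \<omega>)"
  using assms forecast_set_nonempty
  unfolding nondegenerate_def more_conservative_on_def mk_preq_path_def forecasts_along_def
  by (metis fst_conv snd_conv subset_singletonD)

theorem proposition10:
  fixes \<phi> :: forecasting_system and \<iota> :: "nat \<Rightarrow> rat_forecast" and \<omega> :: path
  assumes "recursive_forecasting_system \<phi>"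
    and "game_random (mk_preq_path \<iota> \<omega>)"
    and "more_conservative_on \<phi> \<iota> \<omega>"
  shows "game_random (mk_preq_path (forecasts_along \<phi> \<omega>) \<omega>)"
  unfolding game_random_def
proof (intro conjI allI impI)
  show "nondegenerate (mk_preq_path (forecasts_along \<phi> \<omega>) \<omega>)"
    using assms(2,3) nondegenerate_more_conservative unfolding game_random_def by blast
next
  fix F assume "test_superfarthingale F \<and> lower_semicomputable preq_situation_code F"
  then have "limsup (\<lambda>n. ereal (replayed \<phi> F (prefix (mk_preq_path \<iota> \<omega>) n))) < \<infinity>"
    using assms(1,2) test_superfarthingale_replayed lower_semicomputable_replayed
    unfolding game_random_def by blast
  then show "limsup (\<lambda>n. ereal (F (prefix (mk_preq_path (forecasts_along \<phi> \<omega>) \<omega>) n))) < \<infinity>"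
    by (simp add: replayed_def replay_prefix[OF assms(3)])
qed

end
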